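(* Let $G=(V,E)$ be an (unsigned) graph with $n=|V|\ge2$, regarded as the signed graph with $\sigma\equiv+1$, with edge weight $w\equiv1$, vertex measure $\mu\equiv1$ and potential $\kappa\equiv0$. Then $L_2>0$ if and only if $G$ is complete. Moreover, if $G$ is complete, then $L_2=\frac12$ and $L_n=\frac n4$ if $n$ is even, $L_n=\frac{\sqrt{n^2-1}}4$ if $n$ is odd.
   Context: $G=(V,E)$ is a finite undirected graph without self-loops, $V=\{1,\dots,n\}$. For $p\ge1$ and nonzero $f$, $\mathcal R_p(f)=\frac{\sum_{\{i,j\}\in E}|f(i)-f(j)|^p}{\sum_i|f(i)|^p}$; $\mathcal S_p=\{f:\sum_i|f(i)|^p=1\}$; Krasnoselskii genus $\gamma(B)$ of closed symmetric $B\subset\mathbb R^n\setminus\{0\}$: least $k$ with an odd continuous map $B\to\mathbb R^k\setminus\{0\}$; $\mathcal F_k(\mathcal S_p)$ = closed symmetric $B\subset\mathcal S_p$ with $\gamma(B)\ge k$; $\lambda_k^{(p)}=\min_{B\in\mathcal F_k(\mathcal S_p)}\max_{f\in B}\mathcal R_p(f)$. Cut-off adjacency eigenvalues: $L_k:=\lim_{p\to\infty}2^{-p}\lambda_k^{(p)}$ (the limits exist). *)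

theory Defs
  imports "HOL-Analysis.Analysis" "HOL-Library.Extended_Nat"
begin

text \<open>Vertices are the elements of a finite type 'n (so V has n = CARD('n) elements),
  functions on V are vectors f :: real^'n.  The graph is a symmetric irreflexive
  adjacency relation E on 'n; every unordered edge {i,j} appears as the two ordered
  pairs (i,j),(j,i), hence the factor 1/2 in the numerator.\<close>

definition simple_graph :: "('n \<Rightarrow> 'n \<Rightarrow> bool) \<Rightarrow> bool" where
  "simple_graph E \<longleftrightarrow> (\<forall>i j. E i j \<longrightarrow> E j i) \<and> (\<forall>i. \<not> E i i)"

definition complete_graph :: "('n \<Rightarrow> 'n \<Rightarrow> bool) \<Rightarrow> bool" where
  "complete_graph E \<longleftrightarrow> (\<forall>i j. i \<noteq> j \<longrightarrow> E i j)"

text \<open>p-Rayleigh quotient (sigma = 1, w = 1, mu = 1, kappa = 0).\<close>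
definition rayleigh_p :: "('n::finite \<Rightarrow> 'n \<Rightarrow> bool) \<Rightarrow> real \<Rightarrow> real^'n \<Rightarrow> real" where
  "rayleigh_p E p f =
     ((\<Sum>i\<in>UNIV. \<Sum>j\<in>UNIV. if E i j then \<bar>f$i - f$j\<bar> powr p else 0) / 2)
     / (\<Sum>i\<in>UNIV. \<bar>f$i\<bar> powr p)"

definition p_sphere :: "real \<Rightarrow> (real^'n::finite) set" where
  "p_sphere p = {f. (\<Sum>i\<in>UNIV. \<bar>f$i\<bar> powr p) = 1}"

text \<open>An odd continuous map B \<rightarrow> R^m \ {0}, written by its m component functions.\<close>
definition odd_nonvanishing_map :: "('a::real_normed_vector) set \<Rightarrow> nat \<Rightarrow> bool" where
  "odd_nonvanishing_map B m \<longleftrightarrow>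
     (\<exists>g :: nat \<Rightarrow> 'a \<Rightarrow> real.
        (\<forall>i<m. continuous_on B (g i) \<and> (\<forall>x\<in>B. g i (- x) = - g i x)) \<and>
        (\<forall>x\<in>B. \<exists>i<m. g i x \<noteq> 0))"

definition kr_genus :: "('a::real_normed_vector) set \<Rightarrow> enat" where
  "kr_genus B = (if \<exists>m. odd_nonvanishing_map B m
                 then enat (LEAST m. odd_nonvanishing_map B m) else \<infinity>)"

definition genus_family :: "real \<Rightarrow> nat \<Rightarrow> (real^'n::finite) set set" where
  "genus_family p k = {B. B \<subseteq> p_sphere p \<and> closed B \<and> (\<forall>x\<in>B. - x \<in> B)
                          \<and> 0 \<notin> B \<and> kr_genus B \<ge> enat k}"

definition var_eig :: "('n::finite \<Rightarrow> 'n \<Rightarrow> bool) \<Rightarrow> real \<Rightarrow> nat \<Rightarrow> real" where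
  "var_eig E p k = Inf ((\<lambda>B. Sup (rayleigh_p E p ` B)) ` (genus_family p k :: (real^'n) set set))"

definition cutoff_eig :: "('n::finite \<Rightarrow> 'n \<Rightarrow> bool) \<Rightarrow> nat \<Rightarrow> real" where
  "cutoff_eig E k = Lim at_top (\<lambda>p::real. var_eig E p k / 2 powr p)"

end

theory Submission
  imports Defs "HOL-Homology.Homology" "HOL-Real_Asymp.Real_Asymp"
begin

text \<open>On the p-sphere put \<open>a\<^sub>i = \<bar>f\<^sub>i\<bar>\<^sup>p\<close>. After division by \<open>2\<^sup>p\<close> an edge whose ends have opposite
  signs contributes the \<open>p\<close>-th power of the mean of \<open>\<bar>f\<^sub>i\<bar>\<close> and \<open>\<bar>f\<^sub>j\<bar>\<close>, which is at least the
  geometric mean of \<open>a\<^sub>i\<close> and \<open>a\<^sub>j\<close> and converges to it uniformly, while the other edges are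
  negligible. On a complete graph the scaled quotient is therefore uniformly close to the product
  \<open>N f\<close> of the sums of \<open>\<surd>a\<^sub>i\<close> over the positive and over the negative vertices.

  A set of genus at least 2 contains an \<open>f\<close> whose positive and negative parts carry the same mass
  (otherwise the difference of the masses is an odd nonvanishing function), and there \<open>N f \<ge> 1/2\<close>;
  functions supported on two vertices show that this is optimal, and on two nonadjacent vertices
  that the limit vanishes for a graph that is not complete.

  A symmetric subset missing a pair \<open>\<plusminus>y\<close> of the p-sphere projects oddly along \<open>y\<close> and has genus
  less than \<open>n\<close>, while the whole p-sphere has genus at least \<open>n\<close> by Borsuk--Ulam. Hence \<open>L\<^sub>n\<close> is the
  maximum of \<open>N\<close>, which Cauchy--Schwarz evaluates. The Borsuk--Ulam theorem is reduced by polynomial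
  approximation to the fact that a differentiable odd map of spheres has odd degree, proved by
  induction on the dimension: a homotopy makes the map preserve the equator.\<close>

section \<open>The Borsuk--Ulam theorem\<close>

lemma nsphere_top_of_set:
  "nsphere m = top_of_set {x. (\<Sum>i\<le>m. (x i)\<^sup>2) = 1 \<and> (\<forall>i>m. x i = 0)}"
  by (simp add: nsphere euclidean_product_topology)

text \<open>Radial projection onto the \<open>m\<close>-sphere. Coordinates beyond \<open>m\<close>
  are set to zero because \<open>nsphere m\<close> consists of real sequences.\<close>

definition unitize :: "nat \<Rightarrow> (nat \<Rightarrow> real) \<Rightarrow> nat \<Rightarrow> real" where
  "unitize m v = (\<lambda>i. if i \<le> m then v i / sqrt (\<Sum>j\<le>m. (v j)\<^sup>2) else 0)"

lemma sum_squares_pos: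
  fixes v :: "nat \<Rightarrow> real"
  assumes "i \<le> m" "v i \<noteq> 0"
  shows "(\<Sum>j\<le>m. (v j)\<^sup>2) > 0"
  using assms by (intro sum_pos2[of _ i]) auto

lemma unitize_in_nsphere:
  assumes "\<exists>i\<le>m. v i \<noteq> 0"
  shows "unitize m v \<in> topspace (nsphere m)"
proof -
  have pos: "(\<Sum>j\<le>m. (v j)\<^sup>2) > 0" using assms sum_squares_pos by blast
  have "(\<Sum>i\<le>m. (unitize m v i)\<^sup>2) = (\<Sum>i\<le>m. (v i)\<^sup>2 / (\<Sum>j\<le>m. (v j)\<^sup>2))"
    using pos by (intro sum.cong) (auto simp: unitize_def power_divide)
  also have "\<dots> = 1" using pos by (simp flip: sum_divide_distrib)
  finally show ?thesis by (simp add: nsphere unitize_def)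
qed

lemma unitize_uminus: "unitize m (\<lambda>i. - v i) = (\<lambda>i. - unitize m v i)"
  by (auto simp: unitize_def)

lemma unitize_cong: "(\<And>i. i \<le> m \<Longrightarrow> v i = w i) \<Longrightarrow> unitize m v = unitize m w"
  by (auto simp: unitize_def fun_eq_iff)

text \<open>All spheres lie in one space of sequences, so the equator of the next sphere is
  literally the \<open>k\<close>-sphere and the induction on dimension needs no reindexing.\<close>

lemma unitize_Suc_eq:
  assumes "v (Suc k) = 0"
  shows "unitize (Suc k) v = unitize k v"
  using assms by (auto simp: unitize_def fun_eq_iff le_Suc_eq)

lemma continuous_on_unitize:
  assumes "\<And>i. i \<le> m \<Longrightarrow> continuous_on A (\<lambda>x. F x i)"
    and "\<And>x. x \<in> A \<Longrightarrow> \<exists>i\<le>m. F x i \<noteq> 0"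
  shows "continuous_on A (\<lambda>x. unitize m (F x))"
proof (rule continuous_on_coordinatewise_then_product)
  fix i
  have pos: "(\<Sum>j\<le>m. (F x j)\<^sup>2) > 0" if "x \<in> A" for x
    using assms(2)[OF that] sum_squares_pos by blast
  show "continuous_on A (\<lambda>x. unitize m (F x) i)"
  proof (cases "i \<le> m")
    case True
    have "continuous_on A (\<lambda>x. F x i / sqrt (\<Sum>j\<le>m. (F x j)\<^sup>2))"
      using True pos by (intro continuous_intros assms(1)) (auto simp: less_imp_neq[symmetric])
    then show ?thesis using True by (simp add: unitize_def)
  qed (simp add: unitize_def)
qed

lemma continuous_map_unitize:
  assumes "\<And>i. i \<le> m \<Longrightarrow> continuous_on (topspace (nsphere m)) (\<lambda>x. F x i)"
    and "\<And>x. x \<in> topspace (nsphere m) \<Longrightarrow> \<exists>i\<le>m. F x i \<noteq> 0"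
  shows "continuous_map (nsphere m) (nsphere m) (\<lambda>x. unitize m (F x))"
  using continuous_on_unitize[OF assms] unitize_in_nsphere[OF assms(2)]
  by (auto simp: nsphere_top_of_set)

text \<open>Normalizing a nowhere vanishing family gives a homotopy of self-maps of the sphere, and
  the degree is a homotopy invariant.\<close>

lemma Brouwer_degree2_unitize_homotopic:
  fixes H :: "real \<Rightarrow> (nat \<Rightarrow> real) \<Rightarrow> nat \<Rightarrow> real"
  assumes "\<And>i. i \<le> m \<Longrightarrow> continuous_on ({0..1} \<times> topspace (nsphere m)) (\<lambda>z. H (fst z) (snd z) i)"
    and "\<And>t x. t \<in> {0..1} \<Longrightarrow> x \<in> topspace (nsphere m) \<Longrightarrow> \<exists>i\<le>m. H t x i \<noteq> 0"
  shows "Brouwer_degree2 m (\<lambda>x. unitize m (H 0 x)) = Brouwer_degree2 m (\<lambda>x. unitize m (H 1 x))"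
proof (rule Brouwer_degree2_homotopic)
  let ?S = "{x. (\<Sum>i\<le>m. (x i)\<^sup>2) = 1 \<and> (\<forall>i>m. x i = 0)} :: (nat \<Rightarrow> real) set"
  have S: "topspace (nsphere m) = ?S" by (simp add: nsphere)
  have cont: "continuous_on ({0..1} \<times> ?S) (\<lambda>z. unitize m (H (fst z) (snd z)))"
    using assms S by (intro continuous_on_unitize) auto
  have "unitize m (H t x) \<in> ?S" if "t \<in> {0..1}" "x \<in> ?S" for t x
    using unitize_in_nsphere assms(2) that S by metis
  then have "continuous_map (prod_topology (top_of_set {0..1}) (nsphere m)) (nsphere m)
      (\<lambda>z. unitize m (H (fst z) (snd z)))"
    using cont by (auto simp: nsphere_top_of_set)
  then show "homotopic_with (\<lambda>x. True) (nsphere m) (nsphere m)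
      (\<lambda>x. unitize m (H 0 x)) (\<lambda>x. unitize m (H 1 x))"
    unfolding homotopic_with_def by fastforce
qed

section \<open>A point missed by ratios of differentiable functions\<close>

text \<open>The cylinder lies in the frontier of the convex solid cylinder, and frontiers of convex
  sets are null.\<close>

lemma negligible_cylinder:
  fixes I :: "'n::finite set"
  shows "negligible {y::real^'n. norm (\<chi> k. if k \<in> I then y $ k else 0) = 1}"
proof -
  define W :: "real^'n \<Rightarrow> real^'n" where "W y = (\<chi> k. if k \<in> I then y $ k else 0)" for y
  have lin: "linear W" by (rule linearI) (auto simp: W_def vec_eq_iff)
  define C where "C = {y. norm (W y) \<le> 1}"
  have C: "C = W -` cball 0 1" by (auto simp: C_def)
  have "convex C" unfolding C by (rule convex_linear_vimage[OF lin]) simp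
  moreover have "{y. norm (W y) = 1} \<subseteq> frontier C"
  proof
    fix y assume "y \<in> {y. norm (W y) = 1}"
    then have y: "norm (W y) = 1" by simp
    \<comment> \<open>Scaling by \<open>1 + t\<close> with small \<open>t > 0\<close> stays near
      \<open>y\<close> but leaves \<open>C\<close>.\<close>
    have "y \<notin> interior C"
    proof
      assume "y \<in> interior C"
      moreover have "continuous (at_right 0) (\<lambda>t::real. (1 + t) *\<^sub>R y)"
        by (intro continuous_intros)
      then have "((\<lambda>t::real. (1 + t) *\<^sub>R y) \<longlongrightarrow> y) (at_right 0)"
        by (simp add: continuous_within)
      ultimately have "\<forall>\<^sub>F t in at_right 0. (1 + t) *\<^sub>R y \<in> interior C"
        using topological_tendstoD open_interior by blast
      then have "\<forall>\<^sub>F t::real in at_right 0. t > 0 \<and> (1 + t) *\<^sub>R y \<in> interior C"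
        by (intro eventually_conj) (auto simp: eventually_at_right_less)
      then obtain t :: real where "t > 0" "(1 + t) *\<^sub>R y \<in> interior C"
        using eventually_happens trivial_limit_at_right_real by blast
      then have "norm (W ((1 + t) *\<^sub>R y)) \<le> 1" using interior_subset C_def by blast
      then show False using y \<open>t > 0\<close> by (simp add: linear_scale[OF lin])
    qed
    then show "y \<in> frontier C"
      using y closure_subset[of C] by (auto simp: frontier_def C_def)
  qed
  ultimately have "negligible {y. norm (W y) = 1}"
    by (metis negligible_convex_frontier negligible_subset)
  then show ?thesis by (simp add: W_def)
qed

text \<open>The ratios range over the differentiable image of a null set (the unit sphere in the first
  \<open>m\<close> coordinates, thickened to a cylinder), so some point is missed.\<close>

lemma obtain_avoiding_ratios:
  fixes d :: "'n::finite \<Rightarrow> nat" and P :: "nat \<Rightarrow> real^'n \<Rightarrow> real"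
  assumes d: "bij_betw d UNIV {..<CARD('n)}" and m: "m \<le> CARD('n)"
    and P: "\<And>i. i \<le> m \<Longrightarrow> P i differentiable_on UNIV"
  obtains b :: "nat \<Rightarrow> real" where
    "\<And>x. norm x = 1 \<Longrightarrow> (\<And>k. d k \<ge> m \<Longrightarrow> x $ k = 0) \<Longrightarrow> P m x \<noteq> 0 \<Longrightarrow> \<exists>i<m. P i x \<noteq> b i * P m x"
proof -
  define W :: "real^'n \<Rightarrow> real^'n" where "W y = (\<chi> k. if k \<in> {k. d k < m} then y $ k else 0)" for y
  have lin: "linear W" by (rule linearI) (auto simp: W_def vec_eq_iff)
  define T where "T = {y. norm (W y) = 1 \<and> P m (W y) \<noteq> 0}"
  \<comment> \<open>Keeping the coordinates from \<open>m\<close> on makes domain and codomain equal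
    in dimension, so that differentiability carries null sets to null sets.\<close>
  define \<Phi> :: "real^'n \<Rightarrow> real^'n" where
    "\<Phi> y = (\<chi> k. if d k < m then P (d k) (W y) / P m (W y) else y $ k)" for y
  have "negligible T"
    by (rule negligible_subset[OF negligible_cylinder[of "{k. d k < m}"]]) (auto simp: T_def W_def)
  have PW: "(\<lambda>y. P i (W y)) differentiable (at y within T)" if "i \<le> m" for i y
  proof -
    have "P i differentiable (at (W y) within W ` T)"
      by (rule differentiable_within_subset[of _ _ UNIV]) (use P[OF that] in \<open>auto simp: differentiable_on_def\<close>)
    then show ?thesis
      using differentiable_chain_within[of W y T "P i"] linear_imp_differentiable[OF lin]
      by (simp add: o_def)
  qed
  have "\<Phi> differentiable_on T"
    unfolding differentiable_on_def
  proof
    fix y assume y: "y \<in> T"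
    show "\<Phi> differentiable (at y within T)"
    proof (subst differentiable_componentwise_within, rule ballI)
      fix i :: "real^'n" assume "i \<in> Basis"
      then obtain k where i: "i = axis k 1" by (auto simp: Basis_vec_def)
      show "(\<lambda>x. \<Phi> x \<bullet> i) differentiable (at y within T)"
      proof (cases "d k < m")
        case True
        have "(\<lambda>y. P (d k) (W y) / P m (W y)) differentiable (at y within T)"
          using y True by (intro differentiable_divide PW) (auto simp: T_def)
        then show ?thesis using True by (simp add: i inner_axis \<Phi>_def)
      next
        case False
        then show ?thesis
          by (simp add: i inner_axis \<Phi>_def bounded_linear_imp_differentiable bounded_linear_vec_nth)
      qed
    qed
  qed
  then have "negligible (\<Phi> ` T)"
    using \<open>negligible T\<close> by (intro negligible_differentiable_image_negligible) auto
  then obtain z where z: "z \<notin> \<Phi> ` T" using non_negligible_UNIV by (metis UNIV_eq_I)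
  define e where "e = inv_into UNIV d"
  have ed: "e (d k) = k" for k
    using d unfolding e_def by (simp add: bij_betw_def)
  show thesis
  proof (rule that[of "\<lambda>i. z $ e i"])
    fix x :: "real^'n" assume x: "norm x = 1" "\<And>k. d k \<ge> m \<Longrightarrow> x $ k = 0" "P m x \<noteq> 0"
    show "\<exists>i<m. P i x \<noteq> z $ e i * P m x"
    proof (rule ccontr)
      assume neg: "\<not> (\<exists>i<m. P i x \<noteq> z $ e i * P m x)"
      \<comment> \<open>The first coordinates of \<open>x\<close> completed by those of
        \<open>z\<close> would be a preimage of \<open>z\<close> in \<open>T\<close>.\<close>
      define y :: "real^'n" where "y = (\<chi> k. if d k < m then x $ k else z $ k)"
      have Wy: "W y = x" using x(2) by (auto simp: W_def y_def vec_eq_iff not_less)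
      have "y \<in> T" using x by (simp add: T_def Wy)
      moreover have "\<Phi> y $ k = z $ k" for k
      proof (cases "d k < m")
        case True
        then have "P (d k) x = z $ k * P m x" using neg by (auto simp: ed)
        then show ?thesis using True x(3) by (simp add: \<Phi>_def Wy)
      qed (simp add: \<Phi>_def y_def)
      then have "\<Phi> y = z" by (simp add: vec_eq_iff)
      ultimately show False using z by blast
    qed
  qed
qed

section \<open>Parity of the degree of odd maps\<close>

text \<open>Passes from the sequence model, where degrees live, to \<open>real^'n\<close>, where
  differentiability does.\<close>

lemma norm_reindex_nsphere:
  fixes d :: "'n::finite \<Rightarrow> nat"
  assumes d: "bij_betw d UNIV {..<CARD('n)}" and m: "m < CARD('n)"
    and "x \<in> topspace (nsphere m)"
  shows "norm (\<chi> k. x (d k)) = 1"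
proof -
  have x: "(\<Sum>i\<le>m. (x i)\<^sup>2) = 1" "\<And>i. i > m \<Longrightarrow> x i = 0" using assms(3) by (auto simp: nsphere)
  have "(norm (\<chi> k. x (d k)))\<^sup>2 = (\<Sum>k\<in>UNIV. (x (d k))\<^sup>2)"
    by (simp add: norm_vec_def L2_set_def sum_nonneg)
  also have "\<dots> = (\<Sum>i<CARD('n). (x i)\<^sup>2)"
    by (rule sum.reindex_bij_betw[OF d])
  also have "\<dots> = (\<Sum>i\<le>m. (x i)\<^sup>2)"
    using x(2) m by (intro sum.mono_neutral_right) auto
  finally show ?thesis using x(1) by (smt (verit) norm_ge_zero power2_eq_1_iff)
qed

text \<open>A homotopy through nonvanishing maps leads to an odd map preserving the equator; its
  degree has the parity of the degree of its restriction there. Differentiability provides the shear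
  used in the homotopy.\<close>

theorem odd_Brouwer_degree2_differentiable:
  fixes d :: "'n::finite \<Rightarrow> nat" and P :: "nat \<Rightarrow> real^'n \<Rightarrow> real"
  assumes d: "bij_betw d UNIV {..<CARD('n)}" and m: "m < CARD('n)"
    and P: "\<And>i. i \<le> m \<Longrightarrow> P i differentiable_on UNIV" "\<And>i x. i \<le> m \<Longrightarrow> P i (- x) = - P i x"
    and nz: "\<And>x. x \<in> topspace (nsphere m) \<Longrightarrow> \<exists>i\<le>m. P i (\<chi> k. x (d k)) \<noteq> 0"
  shows "odd (Brouwer_degree2 m (\<lambda>x. unitize m (\<lambda>i. P i (\<chi> k. x (d k)))))"
  using m P nz
proof (induction m arbitrary: P)
  case 0
  define V :: "(nat \<Rightarrow> real) \<Rightarrow> real^'n" where "V x = (\<chi> k. x (d k))" for x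
  define f where "f = (\<lambda>x. unitize 0 (\<lambda>i. P i (V x)))"
  define e :: "nat \<Rightarrow> real" where "e = (\<lambda>n. if n = 0 then 1 else 0)"
  have e: "e \<in> topspace (nsphere 0)" unfolding e_def by (rule in_topspace_nsphere)
  have S: "x = e \<or> x = (\<lambda>i. - e i)" if "x \<in> topspace (nsphere 0)" for x
    using that by (auto simp: nsphere e_def fun_eq_iff power2_eq_1_iff)
  have V: "V (\<lambda>i. - x i) = - V x" for x by (simp add: V_def vec_eq_iff)
  have f_neg: "f (\<lambda>i. - x i) = (\<lambda>i. - f x i)" for x
    by (simp add: f_def V 0 unitize_def fun_eq_iff)
  have "f e \<in> topspace (nsphere 0)"
    unfolding f_def using 0(4)[OF e] by (intro unitize_in_nsphere) (simp add: V_def)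
  \<comment> \<open>On the two-point sphere an odd map is the identity or the reflection, of degree
    \<open>1\<close> or \<open>-1\<close>.\<close>
  then consider "f e = e" | "f e = (\<lambda>i. - e i)" using S by blast
  then have "\<bar>Brouwer_degree2 0 f\<bar> = 1"
  proof cases
    case 1
    then have "Brouwer_degree2 0 f = Brouwer_degree2 0 id"
      using f_neg[of e] by (intro Brouwer_degree2_eq) (auto dest!: S)
    then show ?thesis by simp
  next
    case 2
    then have "Brouwer_degree2 0 f = Brouwer_degree2 0 (\<lambda>x i. if i = 0 then - x i else x i)"
      using f_neg[of e] by (intro Brouwer_degree2_eq) (auto dest!: S simp: fun_eq_iff e_def)
    then show ?thesis by (simp add: Brouwer_degree2_reflection)
  qed
  then show ?case unfolding f_def V_def by presburger
next
  case (Suc k)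
  define m where "m = Suc k"
  define V :: "(nat \<Rightarrow> real) \<Rightarrow> real^'n" where "V x = (\<chi> k. x (d k))" for x
  have V: "V (\<lambda>i. - x i) = - V x" for x by (simp add: V_def vec_eq_iff)
  have V_cont: "continuous_on A V" for A
    unfolding V_def by (intro continuous_on_vec_lambda continuous_on_subset[OF continuous_on_product_coordinates]) simp
  have P_cont: "continuous_on A (P i)" if "i \<le> m" for i A
    using Suc.prems(2) that m_def differentiable_imp_continuous_on continuous_on_subset by blast
  have odd_P: "P i (- x) = - P i x" if "i \<le> m" for i x using Suc.prems(3) that by (simp add: m_def)
  obtain b where b: "\<And>x. norm x = 1 \<Longrightarrow> (\<And>k. d k \<ge> m \<Longrightarrow> x $ k = 0) \<Longrightarrow> P m x \<noteq> 0
      \<Longrightarrow> \<exists>i<m. P i x \<noteq> b i * P m x"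
    using obtain_avoiding_ratios[OF d, of m P] Suc.prems(1,2) by (auto simp: m_def)
  \<comment> \<open>Shearing by \<open>b\<close> makes the first \<open>m\<close> components alone nonvanishing on the equator, so there the
    last component can be damped to zero; the factor is positive off the equator.\<close>
  define H where "H t x i = (if i < m then P i (V x) - t * b i * P m (V x)
      else (1 - t * (1 - (x m)\<^sup>2)) * P m (V x))" for t and x :: "nat \<Rightarrow> real" and i
  have H_cont: "continuous_on A (\<lambda>z. H (fst z) (snd z) i)" if "i \<le> m" for i A
  proof -
    have PV: "continuous_on A (\<lambda>z. P j (V (snd z)))" if "j \<le> m" for j
      by (intro continuous_on_compose2[OF P_cont[OF that, of UNIV]] continuous_on_compose2[OF V_cont[of UNIV]] continuous_intros) auto
    have xm: "continuous_on A (\<lambda>z. snd z m)"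
      by (rule continuous_on_compose2[OF continuous_on_product_coordinates[of m] continuous_on_snd[OF continuous_on_id]]) auto
    show ?thesis
      by (cases "i < m") (auto simp: H_def that intro!: continuous_intros PV xm)
  qed
  have H_nz: "\<exists>i\<le>m. H t x i \<noteq> 0" if t: "t \<in> {0..1}" and x: "x \<in> topspace (nsphere m)" for t x
  proof (rule ccontr)
    assume "\<not> (\<exists>i\<le>m. H t x i \<noteq> 0)"
    then have 0: "H t x i = 0" if "i \<le> m" for i using that by blast
    have eq: "P i (V x) = t * b i * P m (V x)" if "i < m" for i
      using 0[of i] that by (simp add: H_def)
    have top: "(1 - t * (1 - (x m)\<^sup>2)) * P m (V x) = 0" using 0[of m] by (simp add: H_def)
    have Pm: "P m (V x) \<noteq> 0"
    proof
      assume "P m (V x) = 0"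
      then have "P i (V x) = 0" if "i \<le> m" for i using eq that by (cases "i = m") auto
      then show False using Suc.prems(4) x by (auto simp: m_def V_def)
    qed
    \<comment> \<open>The damping factor vanishes only for \<open>t = 1\<close> and
      \<open>x m = 0\<close>, which is exactly where the choice of \<open>b\<close> applies.\<close>
    then have 1: "t * (1 - (x m)\<^sup>2) = 1" using top by simp
    then have "1 - (x m)\<^sup>2 \<ge> 0"
      using t mult_nonneg_nonpos[of t "1 - (x m)\<^sup>2"] by force
    then have "t * (1 - (x m)\<^sup>2) \<le> 1 - (x m)\<^sup>2"
      using t by (intro mult_left_le_one_le) auto
    then have xm: "x m = 0" using 1 by auto
    then have "t = 1" using 1 by simp
    have "(V x) $ k = 0" if "d k \<ge> m" for k
      using x xm that by (cases "d k = m") (auto simp: V_def nsphere)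
    moreover have "norm (V x) = 1"
      using norm_reindex_nsphere[OF d Suc.prems(1)] x by (simp add: V_def m_def)
    ultimately show False using b[of "V x"] Pm eq \<open>t = 1\<close> by auto
  qed
  define f where "f = (\<lambda>x. unitize m (H 1 x))"
  have "Brouwer_degree2 m (\<lambda>x. unitize m (H 0 x)) = Brouwer_degree2 m f"
    unfolding f_def using H_cont H_nz by (intro Brouwer_degree2_unitize_homotopic) auto
  moreover have "unitize m (H 0 x) = unitize m (\<lambda>i. P i (V x))" for x
    by (rule unitize_cong) (auto simp: H_def)
  ultimately have deg_f: "Brouwer_degree2 m (\<lambda>x. unitize m (\<lambda>i. P i (V x))) = Brouwer_degree2 m f"
    by simp
  have cm: "continuous_map (nsphere m) (nsphere m) f"
    unfolding f_def
  proof (rule continuous_map_unitize)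
    show "continuous_on (topspace (nsphere m)) (\<lambda>x. H 1 x i)" if "i \<le> m" for i
      using continuous_on_compose2[OF H_cont[OF that, of UNIV]
          continuous_on_Pair[OF continuous_on_const[of _ 1] continuous_on_id]]
      by simp
  qed (use H_nz in auto)
  have f_odd: "f (\<lambda>i. - x i) = (\<lambda>i. - f x i)" for x
  proof -
    have "unitize m (H 1 (\<lambda>i. - x i)) = unitize m (\<lambda>i. - H 1 x i)"
      by (rule unitize_cong) (auto simp: H_def V odd_P)
    then show ?thesis by (simp add: f_def unitize_uminus)
  qed
  have sub: "x \<in> topspace (nsphere m)" "x m = 0" if "x \<in> topspace (nsphere k)" for x
    using that by (auto simp: nsphere m_def)
  have H1: "H 1 x m = 0" if "x m = 0" for x using that by (simp add: H_def)
  have f_equator: "f \<in> topspace (nsphere (m - Suc 0)) \<rightarrow> topspace (nsphere (m - Suc 0))"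
  proof
    fix x assume "x \<in> topspace (nsphere (m - Suc 0))"
    then have x: "x \<in> topspace (nsphere k)" by (simp add: m_def)
    have "f x m = 0" using H1 sub(2)[OF x] by (simp add: f_def unitize_def)
    then show "f x \<in> topspace (nsphere (m - Suc 0))"
      using continuous_map_image_subset_topspace[OF cm] sub(1)[OF x]
      by (intro topspace_nsphere_minus1) auto
  qed
  \<comment> \<open>The sheared components, which describe \<open>f\<close> on the equator; they are
    odd and differentiable, so the induction hypothesis applies to them.\<close>
  define Q where "Q i x = P i x - b i * P m x" for i x
  have fk: "f x = unitize k (\<lambda>i. Q i (V x))" if "x \<in> topspace (nsphere k)" for x
  proof -
    have "f x = unitize k (H 1 x)"
      using H1 sub(2)[OF that] by (simp add: f_def m_def unitize_Suc_eq)
    also have "\<dots> = unitize k (\<lambda>i. Q i (V x))"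
      by (rule unitize_cong) (auto simp: H_def Q_def m_def)
    finally show ?thesis .
  qed
  have "odd (Brouwer_degree2 k (\<lambda>x. unitize k (\<lambda>i. Q i (\<chi> k. x (d k)))))"
  proof (rule Suc.IH)
    show "k < CARD('n)" using Suc.prems(1) by simp
    show "Q i differentiable_on UNIV" if "i \<le> k" for i
      unfolding Q_def using that Suc.prems(2) m_def
      by (intro differentiable_on_diff differentiable_on_mult differentiable_on_const) auto
    show "Q i (- x) = - Q i x" if "i \<le> k" for i x
      using that by (simp add: Q_def odd_P m_def)
    show "\<exists>i\<le>k. Q i (\<chi> k. x (d k)) \<noteq> 0" if x: "x \<in> topspace (nsphere k)" for x
    proof -
      obtain i where i: "i \<le> m" "H 1 x i \<noteq> 0" using H_nz[of 1 x] sub(1)[OF x] by auto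
      then have "i < m" using H1 sub(2)[OF x] by (cases "i = m") auto
      then show ?thesis using i by (auto simp: H_def Q_def V_def m_def less_Suc_eq_le)
    qed
  qed
  then have "odd (Brouwer_degree2 k f)"
    using Brouwer_degree2_eq[of k f "\<lambda>x. unitize k (\<lambda>i. Q i (V x))"] fk by (simp add: V_def)
  moreover have "even (Brouwer_degree2 m f - Brouwer_degree2 (m - Suc 0) f)"
    using cm f_equator f_odd by (intro Borsuk_odd_mapping_degree_step) auto
  ultimately have "odd (Brouwer_degree2 m f)" by (simp add: m_def)
  then show ?case using deg_f by (simp add: m_def V_def)
qed

text \<open>Without a common zero, odd polynomial approximants padded by zero components give an odd
  differentiable self-map of the sphere. It is not surjective, so its degree is zero, which is not
  odd.\<close>

theorem Borsuk_Ulam_sphere: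
  fixes g :: "nat \<Rightarrow> real^'n::finite \<Rightarrow> real"
  assumes m: "m < CARD('n)"
    and cont: "\<And>i. i < m \<Longrightarrow> continuous_on (sphere 0 1) (g i)"
    and odd: "\<And>i x. i < m \<Longrightarrow> x \<in> sphere 0 1 \<Longrightarrow> g i (- x) = - g i x"
  shows "\<exists>x\<in>sphere 0 1. \<forall>i<m. g i x = 0"
proof (rule ccontr)
  assume "\<not> ?thesis"
  then have nz: "\<exists>i<m. g i x \<noteq> 0" if "x \<in> sphere 0 1" for x using that by blast
  define F where "F x = (\<Sum>i<m. \<bar>g i x\<bar>)" for x
  have "axis undefined 1 \<in> (sphere 0 1 :: (real^'n) set)" by (simp add: norm_axis_1)
  then have ne: "sphere 0 1 \<noteq> ({} :: (real^'n) set)" by blast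
  have "continuous_on (sphere 0 1) F"
    unfolding F_def using cont by (intro continuous_intros) auto
  then obtain x0 where x0: "x0 \<in> sphere 0 1" "\<And>x. x \<in> sphere 0 1 \<Longrightarrow> F x0 \<le> F x"
    using continuous_attains_inf[OF compact_sphere ne, of F] by blast
  have F0: "F x0 > 0"
    using nz[OF x0(1)] unfolding F_def by (auto intro: sum_pos2)
  \<comment> \<open>\<open>F x0\<close> is the minimum of \<open>F\<close> on the sphere, and
    \<open>m\<close> errors of size \<epsilon> add up to less than it.\<close>
  define \<epsilon> where "\<epsilon> = F x0 / (real m + 1)"
  have "\<epsilon> > 0" using F0 by (simp add: \<epsilon>_def)
  have "\<exists>q. real_polynomial_function q \<and> (\<forall>x\<in>sphere 0 1. \<bar>g i x - q x\<bar> < \<epsilon>)" if "i < m" for i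
    by (rule Stone_Weierstrass_real_polynomial_function[OF compact_sphere cont[OF that] \<open>\<epsilon> > 0\<close>]) blast
  then obtain q where q: "\<And>i. i < m \<Longrightarrow> real_polynomial_function (q i)"
    "\<And>i x. i < m \<Longrightarrow> x \<in> sphere 0 1 \<Longrightarrow> \<bar>g i x - q i x\<bar> < \<epsilon>" by metis
  \<comment> \<open>Antisymmetrizing makes the approximants odd; zero components are added to reach
    the dimension of the sphere.\<close>
  define P where "P i x = (if i < m then (q i x - q i (- x)) / 2 else 0)" for i x
  have P_diff: "P i differentiable_on UNIV" for i
  proof (cases "i < m")
    case True
    have "polynomial_function (\<lambda>x::real^'n. - x)" by (intro polynomial_function_minus) simp
    then have "real_polynomial_function (\<lambda>x. q i (- x))"
      using real_polynomial_function_compose[OF _ q(1)[OF True]] by (simp add: o_def)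
    then have "real_polynomial_function (\<lambda>x. (q i x - q i (- x)) / 2)"
      using q(1)[OF True] by (intro real_polynomial_function_divide real_polynomial_function_diff)
    moreover have "P i = (\<lambda>x. (q i x - q i (- x)) / 2)"
      using True by (simp add: P_def fun_eq_iff)
    ultimately show ?thesis by (simp add: differentiable_on_real_polynomial_function)
  next
    case False
    then have "P i = (\<lambda>x. 0)" by (simp add: P_def fun_eq_iff)
    then show ?thesis by simp
  qed
  have P_odd: "P i (- x) = - P i x" for i x by (simp add: P_def field_simps)
  have P_nz: "\<exists>i<m. P i x \<noteq> 0" if x: "x \<in> sphere 0 1" for x
  proof (rule ccontr)
    assume 0: "\<not> ?thesis"
    have "\<bar>g i x\<bar> \<le> \<epsilon>" if "i < m" for i
    proof -
      \<comment> \<open>This common value is within \<epsilon> of both \<open>g i x\<close> and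
        \<open>- g i x\<close>.\<close>
      have "q i x = q i (- x)" using 0 that by (simp add: P_def)
      then show ?thesis using q(2)[OF that x] q(2)[OF that, of "- x"] odd[OF that x] x by simp
    qed
    then have "F x \<le> real m * \<epsilon>" unfolding F_def by (intro sum_bounded_above[of "{..<m}", simplified]) auto
    also have "\<dots> < F x0" using F0 by (simp add: \<epsilon>_def field_simps)
    finally show False using x0(2)[OF x] by simp
  qed
  obtain d :: "'n \<Rightarrow> nat" where d: "bij_betw d UNIV {..<CARD('n)}"
    using ex_bij_betw_finite_nat[of "UNIV :: 'n set"] by (auto simp: atLeast0LessThan)
  define M where "M = CARD('n) - 1"
  have M: "M < CARD('n)" "m \<le> M" using m by (auto simp: M_def)
  define F where "F x i = P i (\<chi> k. x (d k))" for i and x :: "nat \<Rightarrow> real"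
  have F_nz: "\<exists>i\<le>M. F x i \<noteq> 0" if "x \<in> topspace (nsphere M)" for x
    using P_nz[of "\<chi> k. x (d k)"] norm_reindex_nsphere[OF d M(1) that] M(2)
    by (auto simp: F_def) (metis order.strict_implies_order order.trans)
  have "odd (Brouwer_degree2 M (\<lambda>x. unitize M (F x)))"
    unfolding F_def using F_nz
    by (intro odd_Brouwer_degree2_differentiable[OF d M(1)] P_diff P_odd) (auto simp: F_def)
  moreover have "Brouwer_degree2 M (\<lambda>x. unitize M (F x)) = 0"
  proof (rule Brouwer_degree2_nonsurjective)
    show "continuous_map (nsphere M) (nsphere M) (\<lambda>x. unitize M (F x))"
    proof (rule continuous_map_unitize[OF _ F_nz])
      have "continuous_on UNIV (\<lambda>x::nat \<Rightarrow> real. \<chi> k. x (d k))"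
        by (intro continuous_on_vec_lambda) simp
      then have "continuous_on UNIV (\<lambda>x. F x i)" for i
        unfolding F_def
        by (intro continuous_on_compose2[OF differentiable_imp_continuous_on[OF P_diff]]) auto
      then show "continuous_on (topspace (nsphere M)) (\<lambda>x. F x i)" for i
        using continuous_on_subset by blast
    qed
    \<comment> \<open>Component \<open>M\<close> is one of the added zeros because
      \<open>m \<le> M\<close>, so the pole is missed.\<close>
    have "unitize M (F x) M = 0" for x using M(2) by (simp add: unitize_def F_def P_def)
    moreover have "(\<lambda>i. if i = M then 1 else 0) \<in> topspace (nsphere M)"
      by (simp add: nsphere if_distrib[of "\<lambda>x. x\<^sup>2"] cong: if_cong)
    ultimately show "(\<lambda>x. unitize M (F x)) ` topspace (nsphere M) \<noteq> topspace (nsphere M)"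
      by (metis (mono_tags, lifting) imageE zero_neq_one)
  qed
  ultimately show False by simp
qed

section \<open>Genus and variational eigenvalues\<close>

lemma kr_genus_ge_iff: "enat k \<le> kr_genus B \<longleftrightarrow> (\<forall>m<k. \<not> odd_nonvanishing_map B m)"
proof (cases "\<exists>m. odd_nonvanishing_map B m")
  case True
  let ?L = "LEAST m. odd_nonvanishing_map B m"
  have "odd_nonvanishing_map B ?L" using True LeastI_ex by metis
  moreover have "\<not> odd_nonvanishing_map B m" if "m < ?L" for m
    using that by (rule not_less_Least)
  ultimately have "k \<le> ?L \<longleftrightarrow> (\<forall>m<k. \<not> odd_nonvanishing_map B m)"
    by (meson not_less order.strict_trans1)
  then show ?thesis using True by (simp add: kr_genus_def)
qed (simp add: kr_genus_def)

lemma not_odd_nonvanishing_map_0: "\<not> odd_nonvanishing_map B 0 \<longleftrightarrow> B \<noteq> {}"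
  by (auto simp: odd_nonvanishing_map_def)

section \<open>The p-sphere and bounds for the min-max values\<close>

text \<open>Odd and continuous off the origin, it carries paths and the Euclidean sphere into the
  p-sphere.\<close>

definition p_normalize :: "real \<Rightarrow> real^'n::finite \<Rightarrow> real^'n" where
  "p_normalize p x = (1 / (\<Sum>i\<in>UNIV. \<bar>x$i\<bar> powr p) powr (1/p)) *\<^sub>R x"

lemma sum_abs_powr_pos:
  fixes x :: "real^'n::finite"
  assumes "x \<noteq> 0" shows "(\<Sum>i\<in>UNIV. \<bar>x$i\<bar> powr p) > 0"
proof -
  obtain i where "x $ i \<noteq> 0" using assms by (auto simp: vec_eq_iff)
  then show ?thesis by (intro sum_pos2[of _ i]) auto
qed

lemma p_normalize_in_p_sphere:
  fixes x :: "real^'n::finite"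
  assumes "p > 0" "x \<noteq> 0" shows "p_normalize p x \<in> p_sphere p"
proof -
  let ?S = "\<Sum>i\<in>UNIV. \<bar>x$i\<bar> powr p"
  have S: "?S > 0" using sum_abs_powr_pos[OF assms(2)] .
  have "(\<Sum>i\<in>UNIV. \<bar>p_normalize p x $ i\<bar> powr p) = (\<Sum>i\<in>UNIV. \<bar>x $ i\<bar> powr p / ?S)"
    using S assms(1) by (intro sum.cong) (auto simp: p_normalize_def abs_mult powr_divide powr_powr)
  also have "\<dots> = 1" using S by (simp flip: sum_divide_distrib)
  finally show ?thesis by (simp add: p_sphere_def)
qed

lemma p_normalize_uminus: "p_normalize p (- x) = - p_normalize p x"
  by (simp add: p_normalize_def)

lemma continuous_on_sum_abs_powr:
  "p > 0 \<Longrightarrow> continuous_on A (\<lambda>x::real^'n::finite. \<Sum>i\<in>UNIV. \<bar>x$i\<bar> powr p)"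
  by (intro continuous_on_sum continuous_on_powr' continuous_on_rabs continuous_on_component
      continuous_on_id continuous_on_const) auto

lemma continuous_on_p_normalize:
  fixes A :: "(real^'n::finite) set"
  assumes "p > 0" "0 \<notin> A" shows "continuous_on A (p_normalize p)"
proof -
  have "(\<Sum>i\<in>UNIV. \<bar>x$i\<bar> powr p) \<noteq> 0" if "x \<in> A" for x
    using sum_abs_powr_pos[of x p] that assms(2) by fastforce
  then show ?thesis
    unfolding p_normalize_def using assms(1)
    by (intro continuous_on_scaleR continuous_on_divide continuous_on_powr continuous_on_sum_abs_powr
        continuous_on_const continuous_on_id) auto
qed

lemma closed_p_sphere: "p > 0 \<Longrightarrow> closed (p_sphere p :: (real^'n::finite) set)"
  unfolding p_sphere_def by (intro closed_Collect_eq continuous_on_sum_abs_powr continuous_on_const)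

lemma p_sphere_uminus: "x \<in> p_sphere p \<Longrightarrow> - x \<in> p_sphere p"
  by (simp add: p_sphere_def)

lemma zero_notin_p_sphere: "0 \<notin> p_sphere p"
  by (simp add: p_sphere_def)

lemma p_sphere_abs_le_1:
  assumes "f \<in> p_sphere p" "p > 0" shows "\<bar>f $ i\<bar> \<le> 1"
proof (rule ccontr)
  assume "\<not> ?thesis"
  then have "1 < \<bar>f $ i\<bar> powr p" using assms(2) by (simp add: gr_one_powr)
  moreover have "\<bar>f $ i\<bar> powr p \<le> (\<Sum>i\<in>UNIV. \<bar>f $ i\<bar> powr p)"
    by (intro member_le_sum) auto
  ultimately show False using assms(1) by (simp add: p_sphere_def)
qed

lemma rayleigh_p_on_p_sphere:
  "f \<in> p_sphere p \<Longrightarrow> rayleigh_p E p f =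
    (\<Sum>i\<in>UNIV. \<Sum>j\<in>UNIV. if E i j then \<bar>f$i - f$j\<bar> powr p else 0) / 2"
  by (simp add: rayleigh_p_def p_sphere_def)

lemma rayleigh_p_nonneg: "rayleigh_p E p f \<ge> 0"
  by (auto simp: rayleigh_p_def intro!: divide_nonneg_nonneg sum_nonneg)

text \<open>A crude count of ordered pairs. It serves for boundedness and for graphs that are not
  complete, where \<open>c\<close> can be taken independent of \<open>p\<close>.\<close>

lemma rayleigh_p_le:
  fixes f :: "real^'n::finite"
  assumes "f \<in> p_sphere p"
    and "\<And>i j. E i j \<Longrightarrow> \<bar>f$i - f$j\<bar> powr p \<le> c" and "c \<ge> 0"
  shows "rayleigh_p E p f \<le> real (CARD('n)\<^sup>2) * c"
proof -
  have "(\<Sum>i\<in>UNIV. \<Sum>j\<in>UNIV. if E i j then \<bar>f$i - f$j\<bar> powr p else 0) \<le> (\<Sum>i\<in>(UNIV::'n set). \<Sum>j\<in>(UNIV::'n set). c)"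
    using assms by (intro sum_mono) auto
  also have "\<dots> = real (CARD('n)\<^sup>2) * c" by (simp add: power2_eq_square)
  finally have "rayleigh_p E p f \<le> real (CARD('n)\<^sup>2) * c / 2"
    using assms(1) by (simp add: rayleigh_p_on_p_sphere)
  also have "\<dots> \<le> real (CARD('n)\<^sup>2) * c" using assms(3) by simp
  finally show ?thesis .
qed

text \<open>Ensures that the real-valued \<open>Sup\<close> in \<open>var_eig\<close> is a genuine
  supremum.\<close>

lemma bdd_above_rayleigh_p:
  fixes B :: "(real^'n::finite) set"
  assumes "B \<subseteq> p_sphere p" "p > 0"
  shows "bdd_above (rayleigh_p E p ` B)"
proof (rule bdd_aboveI2)
  fix f assume "f \<in> B"
  then have f: "f \<in> p_sphere p" using assms by blast
  show "rayleigh_p E p f \<le> real (CARD('n)\<^sup>2) * 2 powr p"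
  proof (rule rayleigh_p_le[OF f])
    fix i j
    have "\<bar>f$i - f$j\<bar> \<le> 2" using p_sphere_abs_le_1[OF f assms(2), of i] p_sphere_abs_le_1[OF f assms(2), of j] by linarith
    then show "\<bar>f$i - f$j\<bar> powr p \<le> 2 powr p" using assms(2) by (intro powr_mono2) auto
  qed simp
qed

lemma genus_family_nonempty:
  assumes "B \<in> genus_family p k" "k \<ge> 1" shows "B \<noteq> {}"
proof -
  have "enat k \<le> kr_genus B" using assms(1) by (simp add: genus_family_def)
  then have "\<not> odd_nonvanishing_map B 0" using assms(2) by (simp add: kr_genus_ge_iff)
  then show ?thesis by (simp add: not_odd_nonvanishing_map_0)
qed

lemma Sup_rayleigh_p_nonneg:
  assumes "B \<in> genus_family p k" "k \<ge> 1" "p > 0"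
  shows "Sup (rayleigh_p E p ` B) \<ge> 0"
proof -
  obtain f where "f \<in> B" using genus_family_nonempty[OF assms(1,2)] by blast
  then have "rayleigh_p E p f \<le> Sup (rayleigh_p E p ` B)"
    using assms by (intro cSup_upper bdd_above_rayleigh_p) (auto simp: genus_family_def)
  then show ?thesis using rayleigh_p_nonneg order.trans by blast
qed

text \<open>One test set suffices: the suprema are nonnegative, so the infimum is over a set bounded
  below.\<close>

lemma var_eig_le:
  assumes "B \<in> genus_family p k" "k \<ge> 1" "p > 0" "\<And>f. f \<in> B \<Longrightarrow> rayleigh_p E p f \<le> c"
  shows "var_eig E p k \<le> c"
proof -
  have "var_eig E p k \<le> Sup (rayleigh_p E p ` B)"
    unfolding var_eig_def
    by (rule cInf_lower) (use assms(1) Sup_rayleigh_p_nonneg[OF _ assms(2,3)] in \<open>auto intro!: bdd_belowI2\<close>)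
  also have "\<dots> \<le> c"
    using genus_family_nonempty[OF assms(1,2)] assms(4) by (intro cSup_least) auto
  finally show ?thesis .
qed

text \<open>\<open>B0\<close> witnesses that the family is nonempty, so that \<open>Inf\<close> is
  meaningful.\<close>

lemma var_eig_ge:
  fixes E :: "'n::finite \<Rightarrow> 'n \<Rightarrow> bool"
  assumes "B0 \<in> (genus_family p k :: (real^'n) set set)" "p > 0"
    and "\<And>B. B \<in> (genus_family p k :: (real^'n) set set) \<Longrightarrow> \<exists>f\<in>B. c \<le> rayleigh_p E p f"
  shows "c \<le> var_eig E p k"
  unfolding var_eig_def
proof (rule cInf_greatest)
  fix s assume "s \<in> (\<lambda>B. Sup (rayleigh_p E p ` B)) ` (genus_family p k :: (real^'n) set set)"
  then obtain B :: "(real^'n) set" where B: "B \<in> genus_family p k" "s = Sup (rayleigh_p E p ` B)" by blast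
  obtain f where "f \<in> B" "c \<le> rayleigh_p E p f" using assms(3)[OF B(1)] by blast
  moreover have "bdd_above (rayleigh_p E p ` B)"
    using B assms(2) by (intro bdd_above_rayleigh_p) (auto simp: genus_family_def)
  ultimately show "c \<le> s" using B cSup_upper by (metis imageI order.trans)
qed (use assms(1) in auto)

section \<open>Sets of genus at least two and of full genus\<close>

text \<open>A path in the set joins two antipodal points, so by the intermediate value theorem every
  odd continuous function has a zero.\<close>

lemma pair_sphere_in_genus_family:
  fixes i j :: "'n::finite"
  assumes "i \<noteq> j" "p > 0"
  shows "{f \<in> p_sphere p. \<forall>l. l \<noteq> i \<longrightarrow> l \<noteq> j \<longrightarrow> f $ l = 0} \<in> genus_family p 2"
    (is "?B \<in> _")
proof -
  have "closed {f :: real^'n. f $ l = 0}" for l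
    by (intro closed_Collect_eq continuous_intros)
  then have "closed (p_sphere p \<inter> (\<Inter>l\<in>-{i,j}. {f :: real^'n. f $ l = 0}))"
    using closed_p_sphere assms(2) by (intro closed_Int closed_INT) auto
  moreover have "?B = p_sphere p \<inter> (\<Inter>l\<in>-{i,j}. {f. f $ l = 0})" by auto
  ultimately have "closed ?B" by simp
  \<comment> \<open>The path runs from \<open>- axis i 1\<close> through \<open>axis j 1\<close> to
    \<open>axis i 1\<close>; the coefficients \<open>t\<close> and \<open>1 - \<bar>t\<bar>\<close>
    never vanish together.\<close>
  define c :: "real \<Rightarrow> real^'n" where "c t = t *\<^sub>R axis i 1 + (1 - \<bar>t\<bar>) *\<^sub>R axis j 1" for t
  have c_nz: "c t \<noteq> 0" for t
  proof
    assume "c t = 0"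
    then have "c t $ i = 0" "c t $ j = 0" by simp_all
    then show False using assms(1) by (simp add: c_def axis_def)
  qed
  define N where "N t = p_normalize p (c t)" for t
  have N_mem: "N t \<in> ?B" for t
    using p_normalize_in_p_sphere[OF assms(2) c_nz] by (auto simp: N_def p_normalize_def c_def axis_def)
  have "continuous_on UNIV N" unfolding N_def
    by (rule continuous_on_compose2[OF continuous_on_p_normalize[OF assms(2), of "-{0}"]])
      (use c_nz in \<open>auto simp: c_def intro!: continuous_intros\<close>)
  then have N_cont: "continuous_on {-1..1} N" using continuous_on_subset by blast
  have "\<not> odd_nonvanishing_map ?B 1"
  proof
    assume "odd_nonvanishing_map ?B 1"
    then obtain g :: "nat \<Rightarrow> real^'n \<Rightarrow> real" where
      g': "\<forall>i<1. continuous_on ?B (g i) \<and> (\<forall>x\<in>?B. g i (- x) = - g i x)" "\<forall>x\<in>?B. \<exists>i<1. g i x \<noteq> 0"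
      unfolding odd_nonvanishing_map_def by (elim exE conjE) (rule that)
    then have g: "continuous_on ?B (g 0)" "\<And>x. x \<in> ?B \<Longrightarrow> g 0 (- x) = - g 0 x"
      "\<And>x. x \<in> ?B \<Longrightarrow> g 0 x \<noteq> 0"
      by auto
    have cont: "continuous_on {-1..1} (\<lambda>t. g 0 (N t))"
      using N_mem by (intro continuous_on_compose2[OF g(1) N_cont]) auto
    have "c (-1) = - c 1" by (simp add: c_def)
    then have "g 0 (N (-1)) = - g 0 (N 1)"
      using g(2)[OF N_mem[of 1]] by (simp add: N_def p_normalize_uminus)
    then have "\<exists>t\<ge>-1. t \<le> 1 \<and> g 0 (N t) = 0"
      using IVT'[of "\<lambda>t. g 0 (N t)" "-1" 0 1] IVT2'[of "\<lambda>t. g 0 (N t)" 1 0 "-1"] cont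
      by (cases "g 0 (N 1) \<ge> 0") auto
    then show False using g(3) N_mem by blast
  qed
  moreover have "\<not> odd_nonvanishing_map ?B 0" using N_mem not_odd_nonvanishing_map_0 by blast
  ultimately have "enat 2 \<le> kr_genus ?B" by (simp add: kr_genus_ge_iff less_2_cases_iff)
  then show ?thesis using \<open>closed ?B\<close> zero_notin_p_sphere
    by (auto simp: genus_family_def p_sphere_uminus)
qed

text \<open>An odd nonvanishing map to fewer than \<open>CARD('n)\<close> coordinates, composed with
  \<open>p_normalize\<close>, would contradict Borsuk--Ulam.\<close>

lemma p_sphere_in_genus_family:
  assumes "p > 0"
  shows "(p_sphere p :: (real^'n::finite) set) \<in> genus_family p CARD('n)"
proof -
  have "\<not> odd_nonvanishing_map (p_sphere p :: (real^'n) set) m" if m: "m < CARD('n)" for m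
  proof
    assume "odd_nonvanishing_map (p_sphere p :: (real^'n) set) m"
    then obtain g :: "nat \<Rightarrow> real^'n \<Rightarrow> real" where
      g': "\<forall>i<m. continuous_on (p_sphere p) (g i) \<and> (\<forall>x\<in>p_sphere p. g i (- x) = - g i x)"
        "\<forall>x\<in>p_sphere p. \<exists>i<m. g i x \<noteq> 0"
      unfolding odd_nonvanishing_map_def by (elim exE conjE) (rule that)
    then have g: "\<And>i. i < m \<Longrightarrow> continuous_on (p_sphere p) (g i)"
      "\<And>i x. i < m \<Longrightarrow> x \<in> p_sphere p \<Longrightarrow> g i (- x) = - g i x"
      "\<And>x. x \<in> p_sphere p \<Longrightarrow> \<exists>i<m. g i x \<noteq> 0"
      by auto
    have mem: "p_normalize p x \<in> p_sphere p" if "x \<in> sphere 0 1" for x :: "real^'n"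
      using that assms by (intro p_normalize_in_p_sphere) auto
    have "\<exists>x\<in>sphere 0 1. \<forall>i<m. g i (p_normalize p x) = 0"
    proof (rule Borsuk_Ulam_sphere[OF m])
      show "continuous_on (sphere 0 1) (\<lambda>x. g i (p_normalize p x))" if "i < m" for i
        using assms mem by (intro continuous_on_compose2[OF g(1)[OF that] continuous_on_p_normalize]) auto
      show "g i (p_normalize p (- x)) = - g i (p_normalize p x)" if "i < m" "x \<in> sphere 0 1" for i x
        using g(2)[OF that(1) mem[OF that(2)]] by (simp add: p_normalize_uminus)
    qed
    then show False using g(3) mem by blast
  qed
  then show ?thesis
    using assms closed_p_sphere zero_notin_p_sphere
    by (auto simp: genus_family_def kr_genus_ge_iff p_sphere_uminus)
qed

text \<open>Reduces the top min-max value to a maximum over the whole p-sphere.\<close>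

lemma genus_family_CARD:
  assumes "p > 0" and B: "B \<in> (genus_family p CARD('n::finite) :: (real^'n) set set)"
  shows "B = p_sphere p"
proof (rule ccontr)
  assume "B \<noteq> p_sphere p"
  have B': "B \<subseteq> p_sphere p" "\<And>x. x \<in> B \<Longrightarrow> - x \<in> B" "\<And>m. m < CARD('n) \<Longrightarrow> \<not> odd_nonvanishing_map B m"
    using B by (auto simp: genus_family_def kr_genus_ge_iff)
  obtain y where y: "y \<in> p_sphere p" "y \<notin> B" using B'(1) \<open>B \<noteq> p_sphere p\<close> by blast
  then have "- y \<notin> B" using B'(2)[of "- y"] by auto
  have "y \<noteq> 0" using y(1) zero_notin_p_sphere by blast
  then obtain k where k: "y $ k \<noteq> 0" by (auto simp: vec_eq_iff)
  have "card (UNIV - {k}) = CARD('n) - 1" by (simp add: card_Diff_singleton)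
  then obtain e where e: "bij_betw e {..<CARD('n) - 1} (UNIV - {k})"
    using ex_bij_betw_nat_finite[of "UNIV - {k}"] by (auto simp: atLeast0LessThan)
  \<comment> \<open>Minors of the pair \<open>x\<close>, \<open>y\<close> with pivot
    \<open>k\<close>: they vanish together only if \<open>x\<close> is a multiple of
    \<open>y\<close>, which on the p-sphere means \<open>x = y\<close> or
    \<open>x = - y\<close>.\<close>
  define g where "g i x = x $ e i * y $ k - x $ k * y $ e i" for i and x :: "real^'n"
  have "\<exists>i<CARD('n) - 1. g i x \<noteq> 0" if x: "x \<in> B" for x
  proof (rule ccontr)
    assume 0: "\<not> ?thesis"
    define s where "s = x $ k / y $ k"
    have "x $ j = s * y $ j" for j
    proof (cases "j = k")
      case False
      then obtain i where "i < CARD('n) - 1" "j = e i"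
        using bij_betw_imp_surj_on[OF e] by blast
      then have "g i x = 0" using 0 by blast
      then show ?thesis using k \<open>j = e i\<close> by (simp add: g_def s_def field_simps)
    qed (use k in \<open>simp add: s_def\<close>)
    then have xs: "x = s *\<^sub>R y" by (simp add: vec_eq_iff)
    have "1 = (\<Sum>i\<in>UNIV. \<bar>x $ i\<bar> powr p)" using x B'(1) by (auto simp: p_sphere_def)
    also have "\<dots> = \<bar>s\<bar> powr p * (\<Sum>i\<in>UNIV. \<bar>y $ i\<bar> powr p)"
      by (simp add: xs abs_mult powr_mult sum_distrib_left)
    finally have "\<bar>s\<bar> powr p = 1" using y(1) by (simp add: p_sphere_def)
    moreover have "\<bar>s\<bar> = (\<bar>s\<bar> powr p) powr (1 / p)" using assms(1) by (simp add: powr_powr)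
    ultimately have "\<bar>s\<bar> = 1" by simp
    then have "x = y \<or> x = - y" using xs by (auto simp: abs_if split: if_splits)
    then show False using x y(2) \<open>- y \<notin> B\<close> by blast
  qed
  then have "odd_nonvanishing_map B (CARD('n) - 1)"
    unfolding odd_nonvanishing_map_def
    by (intro exI[of _ g]) (auto simp: g_def intro!: continuous_intros)
  then show False using B'(3) by simp
qed

section \<open>The limit of the Rayleigh quotient\<close>

lemma powr_half_mult_le:
  fixes a b :: real
  assumes "a \<ge> 0" "b \<ge> 0" "p > 0"
  shows "a powr (p/2) * b powr (p/2) \<le> ((a + b) / 2) powr p"
proof -
  have "a * b \<le> ((a + b) / 2)\<^sup>2"
    using sum_squares_bound[of a b] by (simp add: power2_eq_square field_simps)
  then have "(a * b) powr (p/2) \<le> (((a + b) / 2)\<^sup>2) powr (p/2)"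
    using assms by (intro powr_mono2) auto
  also have "\<dots> = ((a + b) / 2) powr p"
    using assms by (cases "a + b = 0") (auto simp: powr_powr simp flip: powr_numeral)
  finally show ?thesis using assms by (simp add: powr_mult)
qed

text \<open>Mean value theorem, with the derivative bounded by its value at the upper end since
  \<open>q \<ge> 1\<close>. The case \<open>C = 0\<close> is separate, to keep the derivative of
  \<open>powr\<close> away from zero.\<close>

lemma powr_diff_le:
  fixes A C :: real
  assumes "A \<ge> C" "C \<ge> 0" "q \<ge> 1"
  shows "A powr q - C powr q \<le> q * A powr (q - 1) * (A - C)"
proof (cases "C = 0 \<or> A = C")
  case True
  then show ?thesis
  proof
    assume "C = 0"
    have "A powr q = A powr (q - 1) * A" using assms \<open>C = 0\<close>
      by (cases "A = 0") (auto simp: powr_diff)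
    then have "A powr q \<le> q * (A powr (q - 1) * A)"
      using assms mult_right_mono[of 1 q "A powr (q - 1) * A"] by auto
    then show ?thesis using \<open>C = 0\<close> by (simp add: mult.assoc)
  qed simp
next
  case False
  then have C: "0 < C" "C < A" using assms by auto
  have "\<exists>z. C < z \<and> z < A \<and> A powr q - C powr q = (A - C) * (q * z powr (q - 1))"
    using C by (intro MVT2) (auto intro!: derivative_eq_intros)
  then obtain z where z: "C < z" "z < A" "A powr q - C powr q = (A - C) * (q * z powr (q - 1))" by blast
  have "z powr (q - 1) \<le> A powr (q - 1)" using z C assms by (intro powr_mono2) auto
  then have "(A - C) * (q * z powr (q - 1)) \<le> (A - C) * (q * A powr (q - 1))"
    using C assms by (intro mult_left_mono) auto
  then show ?thesis using z(3) by (simp add: mult_ac)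
qed

text \<open>With mean \<open>M\<close> and half-difference \<open>d\<close>, \<open>a * b\<close> is
  the difference of their squares, so the gap is at most \<open>p/2 * M powr (p - 2)\<close> times
  the square of \<open>d\<close>. As \<open>M \<le> 1 - d \<le> exp (- d)\<close>, the exponential
  beats the square uniformly in \<open>a\<close> and \<open>b\<close>.\<close>

lemma power_mean_le_geometric_mean:
  fixes a b :: real
  assumes "0 \<le> a" "a \<le> 1" "0 \<le> b" "b \<le> 1" "p > 2"
  shows "((a + b) / 2) powr p \<le> a powr (p/2) * b powr (p/2) + p / (p - 2)\<^sup>2"
proof -
  define M where "M = (a + b) / 2"
  define d where "d = \<bar>a - b\<bar> / 2"
  have Md: "0 \<le> M" "M \<le> 1 - d" "d \<ge> 0" using assms by (auto simp: M_def d_def abs_if field_simps)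
  have diff: "M\<^sup>2 - a * b = d\<^sup>2" by (simp add: M_def d_def power2_eq_square field_simps)
  have sq: "(M\<^sup>2) powr (r/2) = M powr r" for r
    using Md by (cases "M = 0") (auto simp: powr_powr simp flip: powr_numeral)
  have "M powr p - (a * b) powr (p/2) \<le> (p/2) * (M\<^sup>2) powr (p/2 - 1) * (M\<^sup>2 - a * b)"
  proof -
    have "a * b \<le> M\<^sup>2" using diff zero_le_power2[of d] by linarith
    then show ?thesis using powr_diff_le[of "a * b" "M\<^sup>2" "p/2"] assms sq[of p] by simp
  qed
  also have "\<dots> = (p/2) * (M powr (p - 2) * d\<^sup>2)"
    using sq[of "p - 2"] by (simp add: diff diff_divide_distrib)
  also have "\<dots> \<le> (p/2) * (2 / (p - 2)\<^sup>2)"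
  proof (intro mult_left_mono)
    have "M \<le> exp (- d)" using Md exp_ge_add_one_self[of "- d"] by simp
    then have "M powr (p - 2) \<le> exp (- d) powr (p - 2)" using Md assms by (intro powr_mono2) auto
    also have "\<dots> = exp (- ((p - 2) * d))" by (simp add: powr_def)
    finally have 1: "M powr (p - 2) \<le> exp (- ((p - 2) * d))" .
    have exp_sq: "exp (- y) * y\<^sup>2 \<le> 2" if "y \<ge> 0" for y :: real
      using exp_lower_Taylor_quadratic[OF that] that by (simp add: exp_minus field_simps)
    have "exp (- ((p - 2) * d)) * ((p - 2) * d)\<^sup>2 \<le> 2"
      using Md assms by (intro exp_sq) simp
    then have "exp (- ((p - 2) * d)) * d\<^sup>2 \<le> 2 / (p - 2)\<^sup>2"
      using assms by (simp add: le_divide_eq power_mult_distrib mult_ac)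
    then show "M powr (p - 2) * d\<^sup>2 \<le> 2 / (p - 2)\<^sup>2"
      using mult_right_mono[OF 1, of "d\<^sup>2"] by simp
  qed (use assms in auto)
  finally show ?thesis using assms by (simp add: M_def powr_mult)
qed

definition half_power :: "real \<Rightarrow> real \<Rightarrow> real" where
  "half_power p a = max a 0 powr (p/2)"

text \<open>\<open>half_power p\<close> is set up so that the product below is the sum, over pairs of vertices where
  \<open>f\<close> has opposite signs, of the limiting edge terms \<open>\<bar>f i * f j\<bar> powr (p/2)\<close>.\<close>

definition nodal_product :: "real \<Rightarrow> real^'n::finite \<Rightarrow> real" where
  "nodal_product p f = (\<Sum>i\<in>UNIV. half_power p (f$i)) * (\<Sum>i\<in>UNIV. half_power p (- f$i))"

text \<open>The first summand pays for edges with opposite signs at the ends, the second for edges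
  with \<open>\<bar>a - b\<bar> \<le> 1\<close>, in particular those with equal signs.\<close>

definition limit_error :: "real \<Rightarrow> real" where
  "limit_error p = p / (p - 2)\<^sup>2 + (1/2) powr p"

lemma half_power_simps [simp]:
  "a \<le> 0 \<Longrightarrow> half_power p a = 0" "a \<ge> 0 \<Longrightarrow> half_power p a = a powr (p/2)"
  by (auto simp: half_power_def)

lemma half_power_nonneg [simp]: "half_power p a \<ge> 0"
  by (simp add: half_power_def)

lemma half_power_square: "p > 0 \<Longrightarrow> (half_power p a)\<^sup>2 = max a 0 powr p"
  by (simp add: half_power_def power2_eq_square flip: powr_add)

section \<open>Comparison of the Rayleigh quotient with the nodal product\<close>

text \<open>For opposite signs one product vanishes and the other is bounded by the
  arithmetic-geometric mean inequality; for equal signs both vanish.\<close>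

lemma nodal_term_le:
  assumes "p > 0"
  shows "half_power p a * half_power p (- b) + half_power p (- a) * half_power p b
    \<le> \<bar>a - b\<bar> powr p / 2 powr p"
proof -
  have eq: "\<bar>a - b\<bar> powr p / 2 powr p = (\<bar>a - b\<bar> / 2) powr p" by (simp add: powr_divide)
  consider "a \<ge> 0" "b \<le> 0" | "a \<le> 0" "b \<ge> 0" | "a > 0" "b > 0" | "a < 0" "b < 0" by linarith
  then show ?thesis
  proof cases
    case 1
    then show ?thesis using powr_half_mult_le[of a "- b" p] assms unfolding eq by simp
  next
    case 2
    then show ?thesis using powr_half_mult_le[of "- a" b p] assms unfolding eq by simp
  qed auto
qed

lemma le_nodal_term:
  assumes "p > 2" "\<bar>a\<bar> \<le> 1" "\<bar>b\<bar> \<le> 1"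
  shows "\<bar>a - b\<bar> powr p / 2 powr p
    \<le> half_power p a * half_power p (- b) + half_power p (- a) * half_power p b + limit_error p"
proof -
  have eq: "\<bar>a - b\<bar> powr p / 2 powr p = (\<bar>a - b\<bar> / 2) powr p" by (simp add: powr_divide)
  have small: "p / (p - 2)\<^sup>2 \<ge> 0" "(1/2) powr p \<ge> (0::real)" using assms by auto
  have same: ?thesis if "\<bar>a - b\<bar> \<le> 1"
  proof -
    have "(\<bar>a - b\<bar> / 2) powr p \<le> (1/2) powr p" using that assms by (intro powr_mono2) auto
    then show ?thesis using small unfolding eq limit_error_def
      by (smt (verit) half_power_nonneg mult_nonneg_nonneg)
  qed
  consider "a \<ge> 0" "b \<le> 0" | "a \<le> 0" "b \<ge> 0" | "\<bar>a - b\<bar> \<le> 1" using assms by linarith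
  then show ?thesis
  proof cases
    case 1
    then have "(\<bar>a - b\<bar> / 2) powr p
      \<le> half_power p a * half_power p (- b) + half_power p (- a) * half_power p b + p / (p - 2)\<^sup>2"
      using power_mean_le_geometric_mean[of a "- b" p] assms by simp
    then show ?thesis using small(2) unfolding eq limit_error_def by linarith
  next
    case 2
    then have "(\<bar>a - b\<bar> / 2) powr p
      \<le> half_power p a * half_power p (- b) + half_power p (- a) * half_power p b + p / (p - 2)\<^sup>2"
      using power_mean_le_geometric_mean[of "- a" b p] assms by simp
    then show ?thesis using small(2) unfolding eq limit_error_def by linarith
  qed (rule same)
qed

text \<open>Symmetrized to match the numerator of \<open>rayleigh_p\<close> term by term, which also
  runs over ordered pairs and is halved.\<close>

lemma nodal_product_double_sum:
  "nodal_product p f = (\<Sum>i\<in>UNIV. \<Sum>j\<in>UNIV.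
      half_power p (f$i) * half_power p (- f$j) + half_power p (- f$i) * half_power p (f$j)) / 2"
proof -
  have "(\<Sum>i\<in>UNIV. \<Sum>j\<in>UNIV. half_power p (f$i) * half_power p (- f$j)) = nodal_product p f"
    "(\<Sum>i\<in>UNIV. \<Sum>j\<in>UNIV. half_power p (- f$i) * half_power p (f$j)) = nodal_product p f"
    by (simp add: nodal_product_def sum_product)
      (subst sum.swap, simp add: nodal_product_def sum_product mult.commute)
  then show ?thesis by (simp add: sum.distrib)
qed

lemma rayleigh_p_scaled:
  assumes "f \<in> p_sphere p"
  shows "rayleigh_p E p f / 2 powr p =
    (\<Sum>i\<in>UNIV. \<Sum>j\<in>UNIV. if E i j then \<bar>f$i - f$j\<bar> powr p / 2 powr p else 0) / 2"
proof -
  have "(\<Sum>i\<in>UNIV. \<Sum>j\<in>UNIV. if E i j then \<bar>f$i - f$j\<bar> powr p else 0) / 2 powr p =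
     (\<Sum>i\<in>UNIV. \<Sum>j\<in>UNIV. if E i j then \<bar>f$i - f$j\<bar> powr p / 2 powr p else 0)"
    by (simp add: sum_divide_distrib if_distrib[of "\<lambda>x. x / 2 powr p"] cong: if_cong)
  then show ?thesis using assms by (simp add: rayleigh_p_on_p_sphere)
qed

text \<open>Completeness leaves only the diagonal without edge terms, and there the nodal terms
  vanish because no value is both positive and negative.\<close>

lemma nodal_product_le_rayleigh_p:
  assumes "complete_graph E" "f \<in> p_sphere p" "p > 0"
  shows "nodal_product p f \<le> rayleigh_p E p f / 2 powr p"
proof -
  have "half_power p (f$i) * half_power p (- f$j) + half_power p (- f$i) * half_power p (f$j)
    \<le> (if E i j then \<bar>f$i - f$j\<bar> powr p / 2 powr p else 0)" for i j
  proof (cases "E i j")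
    case False
    then have "i = j" using assms(1) by (auto simp: complete_graph_def)
    then show ?thesis using False by (cases "f $ i \<ge> 0") auto
  qed (use nodal_term_le[OF assms(3)] in auto)
  then show ?thesis
    unfolding rayleigh_p_scaled[OF assms(2)] nodal_product_double_sum
    by (intro divide_right_mono sum_mono) auto
qed

lemma rayleigh_p_le_nodal_product:
  fixes f :: "real^'n::finite"
  assumes "f \<in> p_sphere p" "p > 2"
  shows "rayleigh_p E p f / 2 powr p \<le> nodal_product p f + (real CARD('n))\<^sup>2 * limit_error p"
proof -
  have err: "limit_error p \<ge> 0" using assms by (simp add: limit_error_def)
  let ?t = "\<lambda>i j. half_power p (f$i) * half_power p (- f$j) + half_power p (- f$i) * half_power p (f$j)"
  have "(if E i j then \<bar>f$i - f$j\<bar> powr p / 2 powr p else 0) \<le> ?t i j + limit_error p" for i j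
    using le_nodal_term[of p "f $ i" "f $ j"] p_sphere_abs_le_1[OF assms(1)] assms(2) err
    by (simp add: add_nonneg_nonneg)
  then have "rayleigh_p E p f / 2 powr p \<le> (\<Sum>i\<in>UNIV. \<Sum>j\<in>UNIV. ?t i j + limit_error p) / 2"
    unfolding rayleigh_p_scaled[OF assms(1)] by (intro divide_right_mono sum_mono) auto
  also have "\<dots> = nodal_product p f + (real CARD('n))\<^sup>2 * limit_error p / 2"
    unfolding nodal_product_double_sum by (simp add: sum.distrib power2_eq_square field_simps)
  also have "\<dots> \<le> nodal_product p f + (real CARD('n))\<^sup>2 * limit_error p"
    using err by simp
  finally show ?thesis .
qed

text \<open>The two sums are the masses of the positive and of the negative part of
  \<open>f\<close>.\<close>

lemma p_sphere_nodal_split: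
  assumes "f \<in> p_sphere p" "p > 0"
  shows "(\<Sum>i\<in>UNIV. (half_power p (f$i))\<^sup>2) + (\<Sum>i\<in>UNIV. (half_power p (- f$i))\<^sup>2) = 1"
proof -
  have "(half_power p a)\<^sup>2 + (half_power p (- a))\<^sup>2 = \<bar>a\<bar> powr p" for a
    using assms(2) by (auto simp: half_power_square max_def)
  then show ?thesis using assms(1) by (simp add: p_sphere_def flip: sum.distrib)
qed

lemma mult_le_quarter:
  fixes A B :: real
  assumes "A + B = 1" shows "A * B \<le> 1/4"
proof -
  have "0 \<le> (A - B)\<^sup>2" by simp
  also have "\<dots> = (A + B)\<^sup>2 - 4 * (A * B)" by (simp add: power2_eq_square algebra_simps)
  finally show ?thesis using assms by simp
qed

text \<open>Cauchy--Schwarz on each sign class; the two masses add up to one, so their product is at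
  most \<open>1/4\<close>.\<close>

lemma nodal_product_le:
  fixes f :: "real^'n::finite"
  assumes "f \<in> p_sphere p" "p > 0"
  shows "nodal_product p f \<le> sqrt (real (card {i. f$i > 0} * card {i. f$i < 0})) / 2"
proof -
  define A where "A = (\<Sum>i\<in>UNIV. (half_power p (f$i))\<^sup>2)"
  define B where "B = (\<Sum>i\<in>UNIV. (half_power p (- f$i))\<^sup>2)"
  have AB: "A + B = 1" "A \<ge> 0" "B \<ge> 0"
    using p_sphere_nodal_split[OF assms] by (auto simp: A_def B_def intro: sum_nonneg)
  have CS: "(\<Sum>i\<in>UNIV. half_power p (g i))\<^sup>2 \<le> (\<Sum>i\<in>UNIV. (half_power p (g i))\<^sup>2) * real (card {i. g i > 0})"
    for g :: "'n \<Rightarrow> real"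
  proof -
    have "(\<Sum>i\<in>UNIV. half_power p (g i)) = (\<Sum>i\<in>{i. g i > 0}. half_power p (g i))"
      by (rule sum.mono_neutral_right) (auto simp: not_less)
    also have "\<dots>\<^sup>2 \<le> (\<Sum>i\<in>{i. g i > 0}. (half_power p (g i))\<^sup>2) * real (card {i. g i > 0})"
      by (rule sum_squared_le_sum_of_squares)
    also have "(\<Sum>i\<in>{i. g i > 0}. (half_power p (g i))\<^sup>2) = (\<Sum>i\<in>UNIV. (half_power p (g i))\<^sup>2)"
      by (rule sum.mono_neutral_left) (auto simp: not_less)
    finally show ?thesis .
  qed
  have "(nodal_product p f)\<^sup>2 \<le> (A * real (card {i. f$i > 0})) * (B * real (card {i. f$i < 0}))"
    unfolding nodal_product_def power_mult_distrib
    using CS[of "\<lambda>i. f$i"] CS[of "\<lambda>i. - f$i"] AB by (intro mult_mono) (auto simp: A_def B_def)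
  also have "\<dots> = A * B * real (card {i. f$i > 0} * card {i. f$i < 0})" by simp
  also have "\<dots> \<le> 1/4 * real (card {i. f$i > 0} * card {i. f$i < 0})"
    using mult_le_quarter[OF AB(1)] by (intro mult_right_mono) auto
  also have "\<dots> = (sqrt (real (card {i. f$i > 0} * card {i. f$i < 0})) / 2)\<^sup>2"
    by (simp add: power_divide)
  finally show ?thesis by (rule power2_le_imp_le) simp
qed

text \<open>Both masses equal \<open>1/2\<close>, and for nonnegative terms the square of the sum is
  at least the sum of squares.\<close>

lemma half_le_nodal_product:
  fixes f :: "real^'n::finite"
  assumes "f \<in> p_sphere p" "p > 0"
    and "(\<Sum>i\<in>UNIV. (half_power p (f$i))\<^sup>2) = (\<Sum>i\<in>UNIV. (half_power p (- f$i))\<^sup>2)"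
  shows "1/2 \<le> nodal_product p f"
proof -
  have sq: "(\<Sum>i\<in>UNIV. (half_power p (g i))\<^sup>2) \<le> (\<Sum>i\<in>UNIV. half_power p (g i))\<^sup>2" for g :: "'n \<Rightarrow> real"
  proof -
    have "half_power p (g i) \<le> (\<Sum>i\<in>UNIV. half_power p (g i))" for i
      by (intro member_le_sum) auto
    then show ?thesis
      by (auto simp: power2_eq_square sum_distrib_right intro!: sum_mono mult_left_mono)
  qed
  have "1/2 \<le> (\<Sum>i\<in>UNIV. half_power p (f$i))\<^sup>2" "1/2 \<le> (\<Sum>i\<in>UNIV. half_power p (- f$i))\<^sup>2"
    using p_sphere_nodal_split[OF assms(1,2)] assms(3) sq[of "\<lambda>i. f$i"] sq[of "\<lambda>i. - f$i"] by simp_all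
  then have "(1/2) * (1/2) \<le> (nodal_product p f)\<^sup>2"
    unfolding nodal_product_def power_mult_distrib by (intro mult_mono) auto
  then have "(1/2)\<^sup>2 \<le> (nodal_product p f)\<^sup>2" by (simp add: power2_eq_square)
  then show ?thesis
    by (rule power2_le_imp_le) (simp add: nodal_product_def sum_nonneg)
qed

lemma mult_le_mult_halves:
  fixes x y n :: nat
  assumes "x + y \<le> n"
  shows "x * y \<le> (n div 2) * (n - n div 2)"
proof -
  define a where "a = n div 2"
  have a: "a \<le> n - a" "n - a \<le> a + 1" by (auto simp: a_def)
  have "x * y \<le> x * (n - x)" using assms by (intro mult_left_mono) auto
  moreover have "int x * (int n - int x) \<le> int a * (int n - int a)"
  proof -
    \<comment> \<open>The factors never have strictly opposite signs, since no integer lies strictly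
      between \<open>a\<close> and \<open>n - a\<close>; expanding gives the claim.\<close>
    have "0 \<le> (int a - int x) * (int n - int a - int x)"
      using a by (cases "x \<le> a") (auto intro!: mult_nonneg_nonneg mult_nonpos_nonpos)
    then show ?thesis by (simp add: algebra_simps)
  qed
  then have "int (x * (n - x)) \<le> int (a * (n - a))"
    using assms by (simp add: of_nat_diff a_def)
  ultimately show ?thesis unfolding a_def by linarith
qed

text \<open>The difference of the two masses is odd and continuous, so it cannot be nonvanishing on
  a set of genus at least two.\<close>

lemma exists_balanced:
  assumes "p > 0" "B \<in> (genus_family p 2 :: (real^'n::finite) set set)"
  obtains f where "f \<in> B"
    "(\<Sum>i\<in>UNIV. (half_power p (f$i))\<^sup>2) = (\<Sum>i\<in>UNIV. (half_power p (- f$i))\<^sup>2)"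
proof -
  define g :: "real^'n \<Rightarrow> real" where "g f = (\<Sum>i\<in>UNIV. max (f$i) 0 powr p) - (\<Sum>i\<in>UNIV. max (- f$i) 0 powr p)" for f
  have "continuous_on B g"
    unfolding g_def using assms(1)
    by (intro continuous_on_diff continuous_on_sum continuous_on_powr' continuous_on_max continuous_on_minus
        continuous_on_component continuous_on_id continuous_on_const) auto
  moreover have "g (- f) = - g f" for f by (simp add: g_def)
  moreover have "\<not> odd_nonvanishing_map B 1"
    using assms(2) by (simp add: genus_family_def kr_genus_ge_iff)
  ultimately have "\<exists>f\<in>B. g f = 0"
    unfolding odd_nonvanishing_map_def by (auto dest: spec[of _ "\<lambda>_. g"])
  then show thesis using that assms(1) by (auto simp: g_def half_power_square)
qed

section \<open>Evaluation of the limits\<close>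

lemma tendsto_limit_error: "(limit_error \<longlongrightarrow> 0) at_top"
  unfolding limit_error_def by real_asymp

text \<open>The sandwich shows that the limit exists, so \<open>Lim\<close> returns it.\<close>

lemma cutoff_eig_eqI:
  assumes "\<And>p. p > 2 \<Longrightarrow> l \<le> var_eig E p k / 2 powr p"
    and "\<And>p. p > 2 \<Longrightarrow> var_eig E p k / 2 powr p \<le> l + c * limit_error p"
  shows "cutoff_eig E k = l"
  unfolding cutoff_eig_def
proof (rule tendsto_Lim[OF trivial_limit_at_top_linorder])
  have "((\<lambda>p. l + c * limit_error p) \<longlongrightarrow> l + c * 0) at_top"
    by (intro tendsto_intros tendsto_limit_error)
  then have u: "((\<lambda>p. l + c * limit_error p) \<longlongrightarrow> l) at_top" by simp
  show "((\<lambda>p. var_eig E p k / 2 powr p) \<longlongrightarrow> l) at_top"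
    by (rule tendsto_sandwich[OF _ _ tendsto_const u])
      (use assms in \<open>auto intro: eventually_mono[OF eventually_gt_at_top[of 2]]\<close>)
qed

text \<open>For functions supported on two nonadjacent vertices every edge has an end with value
  zero, so the quotient stays bounded while \<open>2 powr p\<close> grows.\<close>

lemma cutoff_eig_2_not_complete:
  fixes E :: "'n::finite \<Rightarrow> 'n \<Rightarrow> bool"
  assumes "simple_graph E" "\<not> complete_graph E"
  shows "cutoff_eig E 2 = 0"
proof -
  obtain i j where ij: "i \<noteq> j" "\<not> E i j" using assms(2) by (auto simp: complete_graph_def)
  show ?thesis
  proof (rule cutoff_eig_eqI[where c = "real (CARD('n)\<^sup>2)"])
    fix p :: real assume p: "p > 2"
    let ?B = "{f \<in> p_sphere p. \<forall>l. l \<noteq> i \<longrightarrow> l \<noteq> j \<longrightarrow> f $ l = 0}"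
    have B: "?B \<in> genus_family p 2" using ij(1) p by (intro pair_sphere_in_genus_family) auto
    have "0 \<le> var_eig E p 2"
    proof (rule var_eig_ge[OF B])
      show "\<exists>f\<in>B. 0 \<le> rayleigh_p E p f" if "B \<in> genus_family p 2" for B
        using genus_family_nonempty[OF that] rayleigh_p_nonneg by auto
    qed (use p in simp)
    then show "0 \<le> var_eig E p 2 / 2 powr p" by simp
    have "var_eig E p 2 \<le> real (CARD('n)\<^sup>2) * 1"
    proof (rule var_eig_le[OF B])
      fix f assume f: "f \<in> ?B"
      show "rayleigh_p E p f \<le> real (CARD('n)\<^sup>2) * 1"
      proof (rule rayleigh_p_le)
        fix k l assume kl: "E k l"
        then have "\<not> (k \<in> {i,j} \<and> l \<in> {i,j})"
          using ij assms(1) by (auto simp: simple_graph_def)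
        then have "f $ k = 0 \<or> f $ l = 0" using f by auto
        then have "\<bar>f$k - f$l\<bar> \<le> 1"
          using p_sphere_abs_le_1[of f p] f p by auto
        then show "\<bar>f$k - f$l\<bar> powr p \<le> 1" using p by (intro powr_le1) auto
      qed (use f in auto)
    qed (use p in auto)
    then have "var_eig E p 2 / 2 powr p \<le> real (CARD('n)\<^sup>2) / 2 powr p" by (simp add: divide_right_mono)
    also have "\<dots> = real (CARD('n)\<^sup>2) * (1/2) powr p" by (simp add: powr_divide)
    also have "\<dots> \<le> real (CARD('n)\<^sup>2) * limit_error p"
      using p by (intro mult_left_mono) (auto simp: limit_error_def)
    finally show "var_eig E p 2 / 2 powr p \<le> 0 + real (CARD('n)\<^sup>2) * limit_error p" by simp
  qed
qed

lemma cutoff_eig_2_complete: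
  fixes E :: "'n::finite \<Rightarrow> 'n \<Rightarrow> bool"
  assumes "complete_graph E" "CARD('n) \<ge> 2"
  shows "cutoff_eig E 2 = 1/2"
proof -
  obtain i j :: 'n where ij: "i \<noteq> j"
    using assms(2) by (metis card_2_iff' card_le_Suc0_iff_eq finite not_less_eq_eq numeral_2_eq_2 UNIV_I)
  show ?thesis
  proof (rule cutoff_eig_eqI[where c = "(real CARD('n))\<^sup>2"])
    fix p :: real assume p: "p > 2"
    let ?B = "{f \<in> p_sphere p. \<forall>l. l \<noteq> i \<longrightarrow> l \<noteq> j \<longrightarrow> f $ l = 0}"
    have B: "?B \<in> genus_family p 2" using ij p by (intro pair_sphere_in_genus_family) auto
    have "1/2 * 2 powr p \<le> var_eig E p 2"
    proof (rule var_eig_ge[OF B])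
      fix B assume B': "B \<in> (genus_family p 2 :: (real^'n) set set)"
      have "p > 0" using p by simp
      obtain f where f: "f \<in> B"
        and balanced: "(\<Sum>i\<in>UNIV. (half_power p (f$i))\<^sup>2) = (\<Sum>i\<in>UNIV. (half_power p (- f$i))\<^sup>2)"
        using exists_balanced[OF \<open>p > 0\<close> B'] by blast
      have fS: "f \<in> p_sphere p" using f B' by (auto simp: genus_family_def)
      have "1/2 \<le> nodal_product p f" using half_le_nodal_product[OF fS \<open>p > 0\<close> balanced] .
      then have "1/2 \<le> rayleigh_p E p f / 2 powr p"
        using nodal_product_le_rayleigh_p[OF assms(1) fS \<open>p > 0\<close>] by linarith
      then show "\<exists>f\<in>B. 1/2 * 2 powr p \<le> rayleigh_p E p f"
        using f by (auto simp: field_simps)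
    qed (use p in simp)
    then show "1/2 \<le> var_eig E p 2 / 2 powr p" by (simp add: field_simps)
    have "var_eig E p 2 \<le> (1/2 + (real CARD('n))\<^sup>2 * limit_error p) * 2 powr p"
    proof (rule var_eig_le[OF B])
      fix f assume f: "f \<in> ?B"
      \<comment> \<open>At most one vertex of each sign contributes to a nonzero nodal product,
        which is therefore at most \<open>1/2\<close>.\<close>
      have "{k. f$k > 0} \<union> {k. f$k < 0} \<subseteq> {i, j}" using f by force
      then have "card ({k. f$k > 0} \<union> {k. f$k < 0}) \<le> card {i, j}" by (intro card_mono) auto
      then have "card {k. f$k > 0} + card {k. f$k < 0} \<le> 2"
        using ij by (subst (asm) card_Un_disjoint) auto
      then have "card {k. f$k > 0} * card {k. f$k < 0} \<le> 1"
        using mult_le_mult_halves[of "card {k. f$k > 0}" "card {k. f$k < 0}" 2] by simp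
      then have "sqrt (real (card {k. f$k > 0} * card {k. f$k < 0})) \<le> 1"
        by (simp del: of_nat_mult)
      moreover have "nodal_product p f \<le> sqrt (real (card {k. f$k > 0} * card {k. f$k < 0})) / 2"
        using f p by (intro nodal_product_le) auto
      ultimately have "nodal_product p f \<le> 1/2" by linarith
      then have "rayleigh_p E p f / 2 powr p \<le> 1/2 + (real CARD('n))\<^sup>2 * limit_error p"
        using rayleigh_p_le_nodal_product[of f p E] f p by auto
      then show "rayleigh_p E p f \<le> (1/2 + (real CARD('n))\<^sup>2 * limit_error p) * 2 powr p"
        by (simp add: divide_le_eq)
    qed (use p in auto)
    then show "var_eig E p 2 / 2 powr p \<le> 1/2 + (real CARD('n))\<^sup>2 * limit_error p"
      by (simp add: divide_le_eq)
  qed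
qed

lemma cutoff_eig_CARD_complete:
  fixes E :: "'n::finite \<Rightarrow> 'n \<Rightarrow> bool"
  assumes "complete_graph E" "CARD('n) \<ge> 2"
  shows "cutoff_eig E CARD('n) = sqrt (real ((CARD('n) div 2) * (CARD('n) - CARD('n) div 2))) / 2"
proof -
  define a where "a = CARD('n) div 2"
  define b where "b = CARD('n) - a"
  have ab: "a > 0" "b > 0" "a + b = CARD('n)" using assms(2) by (auto simp: a_def b_def)
  define l where "l = sqrt (real (a * b)) / 2"
  have "cutoff_eig E CARD('n) = l"
  proof (rule cutoff_eig_eqI[where c = "(real CARD('n))\<^sup>2"])
    fix p :: real assume p: "p > 2"
    have B: "(p_sphere p :: (real^'n) set) \<in> genus_family p CARD('n)"
      using p by (intro p_sphere_in_genus_family) auto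
    obtain S :: "'n set" where S: "card S = a"
      using ex_card[of a "UNIV :: 'n set"] by (auto simp: a_def)
    then have S': "card (- S) = b" by (simp add: Compl_eq_Diff_UNIV card_Diff_subset b_def)
    \<comment> \<open>Equality case of the upper bound: mass \<open>1/2\<close> on each sign class,
      spread evenly over nearly equal classes of \<open>a\<close> and \<open>b\<close>
      vertices.\<close>
    define f :: "real^'n" where
      "f = (\<chi> i. if i \<in> S then (1 / (2 * real a)) powr (1/p) else - ((1 / (2 * real b)) powr (1/p)))"
    have split: "(\<Sum>i\<in>UNIV. h (i \<in> S)) = real a * h True + real b * h False" for h :: "bool \<Rightarrow> real"
    proof -
      have "(\<Sum>i\<in>UNIV. h (i \<in> S)) = (\<Sum>i\<in>S. h (i \<in> S)) + (\<Sum>i\<in>- S. h (i \<in> S))"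
        by (subst sum.union_disjoint[symmetric]) auto
      also have "(\<Sum>i\<in>S. h (i \<in> S)) = (\<Sum>i\<in>S. h True)" by (intro sum.cong) auto
      also have "(\<Sum>i\<in>- S. h (i \<in> S)) = (\<Sum>i\<in>- S. h False)" by (intro sum.cong) auto
      finally show ?thesis using S S' by simp
    qed
    have "\<bar>f$i\<bar> powr p = (if i \<in> S then 1 / (2 * real a) else 1 / (2 * real b))" for i
      using p ab by (simp add: f_def powr_powr)
    then have f: "f \<in> p_sphere p"
      using split[of "\<lambda>t. if t then 1 / (2 * real a) else 1 / (2 * real b)"] ab by (simp add: p_sphere_def)
    have "half_power p (f$i) = (if i \<in> S then sqrt (1 / (2 * real a)) else 0)"
      "half_power p (- f$i) = (if i \<in> S then 0 else sqrt (1 / (2 * real b)))" for i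
      using p by (simp_all add: f_def powr_powr powr_half_sqrt)
    then have "nodal_product p f = (real a * sqrt (1 / (2 * real a))) * (real b * sqrt (1 / (2 * real b)))"
      using split[of "\<lambda>t. if t then sqrt (1 / (2 * real a)) else 0"]
        split[of "\<lambda>t. if t then 0 else sqrt (1 / (2 * real b))"] by (simp add: nodal_product_def)
    also have "\<dots> = sqrt (real a / 2) * sqrt (real b / 2)"
    proof -
      have "real c * sqrt (1 / (2 * real c)) = sqrt (real c / 2)" if "c > 0" for c
      proof -
        have "real c * sqrt (1 / (2 * real c)) = sqrt ((real c)\<^sup>2 * (1 / (2 * real c)))"
          by (simp only: real_sqrt_mult real_sqrt_abs abs_of_nat)
        also have "(real c)\<^sup>2 * (1 / (2 * real c)) = real c / 2" using that by (simp add: power2_eq_square)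
        finally show ?thesis .
      qed
      then show ?thesis using ab by simp
    qed
    also have "\<dots> = sqrt (real (a * b) / 2\<^sup>2)" by (simp flip: real_sqrt_mult add: power2_eq_square)
    also have "\<dots> = l" unfolding l_def by (simp only: real_sqrt_divide real_sqrt_abs)
    finally have "l \<le> rayleigh_p E p f / 2 powr p"
      using nodal_product_le_rayleigh_p[OF assms(1) f] p by simp
    then have l: "l * 2 powr p \<le> rayleigh_p E p f" by (simp add: le_divide_eq)
    have "l * 2 powr p \<le> var_eig E p CARD('n)"
      \<comment> \<open>The p-sphere is the only competitor, so a single function bounds the
        eigenvalue from below.\<close>
      using genus_family_CARD[of p] f l p by (intro var_eig_ge[OF B]) auto
    then show "l \<le> var_eig E p CARD('n) / 2 powr p" by (simp add: le_divide_eq)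
    have "var_eig E p CARD('n) \<le> (l + (real CARD('n))\<^sup>2 * limit_error p) * 2 powr p"
    proof (rule var_eig_le[OF B])
      fix f :: "real^'n" assume f: "f \<in> p_sphere p"
      have "card ({k. f$k > 0} \<union> {k. f$k < 0}) \<le> CARD('n)" by (intro card_mono) auto
      then have "card {k. f$k > 0} + card {k. f$k < 0} \<le> CARD('n)"
        by (subst (asm) card_Un_disjoint) auto
      then have "card {k. f$k > 0} * card {k. f$k < 0} \<le> a * b"
        unfolding a_def b_def by (rule mult_le_mult_halves)
      then have "sqrt (real (card {k. f$k > 0} * card {k. f$k < 0})) / 2 \<le> l"
        unfolding l_def by (intro divide_right_mono real_sqrt_le_mono of_nat_mono) auto
      moreover have "nodal_product p f \<le> sqrt (real (card {k. f$k > 0} * card {k. f$k < 0})) / 2"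
        using p by (intro nodal_product_le[OF f]) simp
      ultimately have "nodal_product p f \<le> l" by linarith
      then have "rayleigh_p E p f / 2 powr p \<le> l + (real CARD('n))\<^sup>2 * limit_error p"
        using rayleigh_p_le_nodal_product[OF f, of E] p by auto
      then show "rayleigh_p E p f \<le> (l + (real CARD('n))\<^sup>2 * limit_error p) * 2 powr p"
        by (simp add: divide_le_eq)
    qed (use p assms(2) in auto)
    then show "var_eig E p CARD('n) / 2 powr p \<le> l + (real CARD('n))\<^sup>2 * limit_error p"
      by (simp add: divide_le_eq)
  qed
  then show ?thesis by (simp add: l_def a_def b_def)
qed

lemma sqrt_mult_halves:
  "sqrt (real ((n div 2) * (n - n div 2))) / 2 =
    (if even n then real n / 4 else sqrt (real n ^ 2 - 1) / 4)"
proof (cases "even n")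
  case True
  then obtain m where "n = 2 * m" by blast
  then show ?thesis by simp
next
  case False
  then obtain m where m: "n = 2 * m + 1" by (blast elim: oddE)
  have "real n ^ 2 - 1 = 2\<^sup>2 * real (m * (m + 1))" by (simp add: m power2_eq_square algebra_simps)
  then have "sqrt (real n ^ 2 - 1) = 2 * sqrt (real (m * (m + 1)))"
    by (simp only: real_sqrt_mult real_sqrt_abs)
  moreover have "(n div 2) * (n - n div 2) = m * (m + 1)" by (simp add: m)
  ultimately show ?thesis using False by simp
qed

theorem theorem8p5:
  fixes E :: "'n::finite \<Rightarrow> 'n \<Rightarrow> bool"
  assumes "simple_graph E" and "CARD('n) \<ge> 2"
  shows "(cutoff_eig E 2 > 0 \<longleftrightarrow> complete_graph E) \<and>
         (complete_graph E \<longrightarrow>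
            cutoff_eig E 2 = 1/2 \<and>
            cutoff_eig E CARD('n) =
              (if even CARD('n) then real CARD('n) / 4
               else sqrt (real CARD('n) ^ 2 - 1) / 4))"
  using cutoff_eig_2_not_complete[OF assms(1)] cutoff_eig_2_complete[OF _ assms(2), of E]
    cutoff_eig_CARD_complete[OF _ assms(2), of E]
  unfolding sqrt_mult_halves by (cases "complete_graph E") simp_all

end
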